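(* Let $\pi_1:(P_1,\Sigma_1)\to(Q,\Sigma)$ and $\pi_2:(P_2,\Sigma_2)\to(Q,\Sigma)$ be morphisms in the category $\mathcal{P}$, and suppose that $(Q,\Sigma)$ has unique standard monomials. If $(P_1,\Sigma_1)$ and $(P_2,\Sigma_2)$ are flag, then $(P_1,\Sigma_1)\times_{(Q,\Sigma)}(P_2,\Sigma_2)$ is flag.
   Context: For a lattice polytope $P\subset\mathbb{R}^n$, $X_P$ is its set of lattice points, $\mathbb{C}[X_P]$ is the polynomial ring with one variable per lattice point, $mP$ is the $m$-fold Minkowski sum, and $\mathbb{C}[P]$ is the graded algebra whose $m$-th graded component has as basis the lattice points of $mP$, with product given by addition. $I_P$ is the kernel of $\mathbb{C}[X_P]\to\mathbb{C}[P]$. A term order on $P$ is a function $\Sigma:X_P\to\mathbb{R}$. For a monomial $x^{\mathbf m}=x_1^{m_1}\cdots x_k^{m_k}$ put $\Sigma(\mathbf m)=\sum_i m_i\Sigma(x_i)$; monomials are (partially) ordered first by degree and then by the value of $\Sigma$. A monomial is standard if it is not the initial form (sum of largest terms) of any polynomial in $I_P$. Equivalently, for a lattice point $b\in mP$ let $\Delta_b$ be the set of degree $m$ monomials of $\mathbb{C}[X_P]$ mapping to $b$; the standard monomials in $\Delta_b$ are those with minimal $\Sigma$-value. $(P,\Sigma)$ has unique standard monomials if each non-empty $\Delta_b$ has a unique minimal element. $(P,\Sigma)$ is flag if a monomial is standard if and only if each of its degree $2$ divisors is standard, and $x^n$ is standard for every $x\in X_P$ and every $n$. The category $\mathcal{P}$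 has as objects pairs $(P,\Sigma)$ of a lattice polytope and a term order on it; a morphism $\pi:(P,\Sigma)\to(Q,\Gamma)$ is a linear map $P\to Q$, induced by a map on lattices, taking standard monomials of $\Sigma$ to standard monomials of $\Gamma$. Under the hypothesis on $(Q,\Sigma)$, the fiber product $(P_1,\Sigma_1)\times_{(Q,\Sigma)}(P_2,\Sigma_2)$ in $\mathcal{P}$ is the polytope $P_1\times_QP_2=\{(x,y)\in P_1\times P_2:\pi_1(x)=\pi_2(y)\}$ with term order $(\Sigma_1\oplus\Sigma_2)(u,v)=\Sigma_1(u)+\Sigma_2(v)$. *)

theory Defs
  imports "HOL-Analysis.Analysis" "HOL-Library.Poly_Mapping"
begin

section \<open>Lattice polytopes\<close>

text \<open>Any Euclidean space carries the lattice of integer combinations of its standard basis.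
  For \<open>real ^ 'n\<close> this is the usual integer lattice, and for a product type it is the
  product of the two lattices.\<close>

definition int_lattice :: "'a::euclidean_space set" where
  "int_lattice = {x. \<forall>b\<in>Basis. x \<bullet> b \<in> \<int>}"

definition lattice_polytope :: "'a::euclidean_space set \<Rightarrow> bool" where
  "lattice_polytope P \<longleftrightarrow> (\<exists>V. finite V \<and> V \<subseteq> int_lattice \<and> P = convex hull V)"

definition lattice_points :: "'a::euclidean_space set \<Rightarrow> 'a set" where
  "lattice_points P = P \<inter> int_lattice"

text \<open>The sum is the elementwise one of \<^theory>\<open>HOL-Library.Set_Algebras\<close>;
  in particular \<open>minkowski_multiple 0 P = {0}\<close>.\<close>

definition minkowski_multiple :: "nat \<Rightarrow> 'a::euclidean_space set \<Rightarrow> 'a set" where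
  "minkowski_multiple m P = (\<Sum>i<m. P)"

lemma minkowski_multiple_alt:
  "minkowski_multiple m P = {\<Sum>i<m. p i | p. \<forall>i<m. p i \<in> P}"
  by (auto simp: minkowski_multiple_def set_sum_alt)


section \<open>The toric ideal\<close>

text \<open>A monomial in variables indexed by \<open>'a\<close> is a finite multiset over \<open>'a\<close>: the
  multiplicities are the exponents, the size is the degree, sum of multisets is the product of
  monomials, and \<open>\<subseteq>#\<close> is divisibility. A polynomial is a finitely supported map from
  monomials to coefficients, with the convolution product of
  \<^theory>\<open>HOL-Library.Poly_Mapping\<close>.\<close>

type_synonym 'a mpolynomial = "'a multiset \<Rightarrow>\<^sub>0 complex"

definition monomials :: "'a::euclidean_space set \<Rightarrow> 'a multiset set" where
  "monomials P = {m. set_mset m \<subseteq> lattice_points P}"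

definition polynomial_ring :: "'a::euclidean_space set \<Rightarrow> 'a mpolynomial set" where
  "polynomial_ring P = {f. Poly_Mapping.keys f \<subseteq> monomials P}"

text \<open>The basis element of the algebra of a polytope given by a lattice point \<open>b\<close> in
  degree \<open>m\<close> is encoded as the pair \<open>(m, b)\<close>.\<close>

definition polytope_algebra :: "'a::euclidean_space set \<Rightarrow> (nat \<times> 'a \<Rightarrow>\<^sub>0 complex) set" where
  "polytope_algebra P =
     {g. \<forall>(m, b)\<in>Poly_Mapping.keys g. b \<in> lattice_points (minkowski_multiple m P)}"

definition toric_hom :: "'a::euclidean_space mpolynomial \<Rightarrow> (nat \<times> 'a \<Rightarrow>\<^sub>0 complex)" where
  "toric_hom f = (\<Sum>m\<in>Poly_Mapping.keys f.
     Poly_Mapping.single (size m, sum_mset m) (Poly_Mapping.lookup f m))"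

definition toric_ideal :: "'a::euclidean_space set \<Rightarrow> 'a mpolynomial set" where
  "toric_ideal P = {f \<in> polynomial_ring P. toric_hom f = 0}"


section \<open>Term orders and standard monomials\<close>

text \<open>A term order on \<open>P\<close> is represented by a total function on the ambient space, of
  which only the values at the lattice points of \<open>P\<close> are ever used.\<close>

definition weight :: "('a \<Rightarrow> real) \<Rightarrow> 'a multiset \<Rightarrow> real" where
  "weight \<Sigma> m = (\<Sum>x\<in>#m. \<Sigma> x)"

definition monomial_less :: "('a \<Rightarrow> real) \<Rightarrow> 'a multiset \<Rightarrow> 'a multiset \<Rightarrow> bool" where
  "monomial_less \<Sigma> m m' \<longleftrightarrow>
     size m < size m' \<or> (size m = size m' \<and> weight \<Sigma> m < weight \<Sigma> m')"

definition initial_form :: "('a \<Rightarrow> real) \<Rightarrow> 'a mpolynomial \<Rightarrow> 'a mpolynomial" where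
  "initial_form \<Sigma> f =
     (\<Sum>m\<in>{m \<in> Poly_Mapping.keys f. \<forall>m'\<in>Poly_Mapping.keys f. \<not> monomial_less \<Sigma> m m'}.
        Poly_Mapping.single m (Poly_Mapping.lookup f m))"

definition standard_monomial ::
    "'a::euclidean_space set \<Rightarrow> ('a \<Rightarrow> real) \<Rightarrow> 'a multiset \<Rightarrow> bool" where
  "standard_monomial P \<Sigma> m \<longleftrightarrow>
     m \<in> monomials P \<and> \<not> (\<exists>f\<in>toric_ideal P. initial_form \<Sigma> f = Poly_Mapping.single m 1)"

definition monomial_fiber :: "'a::euclidean_space set \<Rightarrow> nat \<Rightarrow> 'a \<Rightarrow> 'a multiset set" where
  "monomial_fiber P m b = {u \<in> monomials P. size u = m \<and> sum_mset u = b}"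

definition unique_standard_monomials ::
    "'a::euclidean_space set \<Rightarrow> ('a \<Rightarrow> real) \<Rightarrow> bool" where
  "unique_standard_monomials P \<Sigma> \<longleftrightarrow>
     (\<forall>m. \<forall>b\<in>lattice_points (minkowski_multiple m P). monomial_fiber P m b \<noteq> {} \<longrightarrow>
        (\<exists>!u. is_arg_min (weight \<Sigma>) (\<lambda>u. u \<in> monomial_fiber P m b) u))"

definition flag :: "'a::euclidean_space set \<Rightarrow> ('a \<Rightarrow> real) \<Rightarrow> bool" where
  "flag P \<Sigma> \<longleftrightarrow>
     (\<forall>m\<in>monomials P. standard_monomial P \<Sigma> m \<longleftrightarrow>
        (\<forall>d. d \<subseteq># m \<and> size d = 2 \<longrightarrow> standard_monomial P \<Sigma> d)) \<and>
     (\<forall>x\<in>lattice_points P. \<forall>n. standard_monomial P \<Sigma> (replicate_mset n x))"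


section \<open>Morphisms and fiber products\<close>

definition polytope_morphism ::
    "('a::euclidean_space \<Rightarrow> 'b::euclidean_space) \<Rightarrow>
     'a set \<Rightarrow> ('a \<Rightarrow> real) \<Rightarrow> 'b set \<Rightarrow> ('b \<Rightarrow> real) \<Rightarrow> bool" where
  "polytope_morphism \<pi> P \<Sigma> Q \<Gamma> \<longleftrightarrow>
     linear \<pi> \<and> \<pi> ` int_lattice \<subseteq> int_lattice \<and> \<pi> ` P \<subseteq> Q \<and>
     (\<forall>m. standard_monomial P \<Sigma> m \<longrightarrow> standard_monomial Q \<Gamma> (image_mset \<pi> m))"

definition fiber_product :: "'a set \<Rightarrow> 'b set \<Rightarrow> ('a \<Rightarrow> 'c) \<Rightarrow> ('b \<Rightarrow> 'c) \<Rightarrow> ('a \<times> 'b) set" where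
  "fiber_product P\<^sub>1 P\<^sub>2 \<pi>\<^sub>1 \<pi>\<^sub>2 = {(x, y) \<in> P\<^sub>1 \<times> P\<^sub>2. \<pi>\<^sub>1 x = \<pi>\<^sub>2 y}"

definition sum_order :: "('a \<Rightarrow> real) \<Rightarrow> ('b \<Rightarrow> real) \<Rightarrow> 'a \<times> 'b \<Rightarrow> real" where
  "sum_order \<Sigma>\<^sub>1 \<Sigma>\<^sub>2 = (\<lambda>(u, v). \<Sigma>\<^sub>1 u + \<Sigma>\<^sub>2 v)"


section \<open>Consistency of the definitions\<close>

lemma int_lattice_Times: "int_lattice = int_lattice \<times> int_lattice"
  by (auto simp: int_lattice_def Basis_prod_def ball_Un)

lemma int_lattice_0: "0 \<in> int_lattice"
  by (simp add: int_lattice_def)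

lemma int_lattice_add: "x \<in> int_lattice \<Longrightarrow> y \<in> int_lattice \<Longrightarrow> x + y \<in> int_lattice"
  by (simp add: int_lattice_def inner_add_left)

lemma minkowski_multiple_0: "minkowski_multiple 0 P = {0}"
  by (simp add: minkowski_multiple_def)

lemma minkowski_multiple_Suc: "minkowski_multiple (Suc m) P = P + minkowski_multiple m P"
  by (simp add: minkowski_multiple_def lessThan_Suc)

lemma sum_mset_monomial:
  "m \<in> monomials P \<Longrightarrow> sum_mset m \<in> lattice_points (minkowski_multiple (size m) P)"
proof (induction m)
  case empty
  then show ?case by (simp add: lattice_points_def minkowski_multiple_0 int_lattice_0)
next
  case (add x m)
  then show ?case
    by (auto simp: monomials_def lattice_points_def minkowski_multiple_Suc int_lattice_add
        intro: set_plus_intro)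
qed

lemma toric_hom_superset:
  assumes "finite A" "Poly_Mapping.keys f \<subseteq> A"
  shows "toric_hom f = (\<Sum>m\<in>A. Poly_Mapping.single (size m, sum_mset m) (Poly_Mapping.lookup f m))"
  unfolding toric_hom_def using assms
  by (intro sum.mono_neutral_left) (auto simp: in_keys_iff)

lemma toric_hom_single:
  "toric_hom (Poly_Mapping.single m c) = Poly_Mapping.single (size m, sum_mset m) c"
  by (simp add: toric_hom_superset[of "{m}"])

lemma toric_hom_add: "toric_hom (f + g) = toric_hom f + toric_hom g"
proof -
  let ?A = "Poly_Mapping.keys f \<union> Poly_Mapping.keys g"
  have "Poly_Mapping.keys (f + g) \<subseteq> ?A" by (rule Poly_Mapping.keys_add)
  then show ?thesis
    by (simp add: toric_hom_superset[of ?A] lookup_add single_add sum.distrib)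
qed

lemma toric_hom_sum: "toric_hom (sum f A) = (\<Sum>x\<in>A. toric_hom (f x))"
  by (induction A rule: infinite_finite_induct) (simp_all add: toric_hom_add, simp_all add: toric_hom_def)

lemma sum_single_keys: "(\<Sum>m\<in>Poly_Mapping.keys f. Poly_Mapping.single m (Poly_Mapping.lookup f m)) = f"
  by (intro poly_mapping_eqI)
     (simp add: lookup_sum lookup_single when_def in_keys_iff cong: sum.cong)

lemma toric_hom_mult: "toric_hom (f * g) = toric_hom f * toric_hom g"
proof -
  have "f * g = (\<Sum>m\<in>Poly_Mapping.keys f. Poly_Mapping.single m (Poly_Mapping.lookup f m)) *
                (\<Sum>m\<in>Poly_Mapping.keys g. Poly_Mapping.single m (Poly_Mapping.lookup g m))"
    by (simp only: sum_single_keys)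
  then show ?thesis
    by (simp add: toric_hom_def[of f] toric_hom_def[of g] sum_product toric_hom_sum
        mult_single toric_hom_single)
qed

lemma toric_hom_in_polytope_algebra:
  assumes "f \<in> polynomial_ring P"
  shows "toric_hom f \<in> polytope_algebra P"
proof -
  have "Poly_Mapping.keys (toric_hom f) \<subseteq> (\<lambda>m. (size m, sum_mset m)) ` Poly_Mapping.keys f"
    unfolding toric_hom_def
    by (rule order_trans[OF Poly_Mapping.keys_sum]) (auto split: if_splits)
  then show ?thesis
    using assms sum_mset_monomial by (fastforce simp: polytope_algebra_def polynomial_ring_def)
qed

lemma lookup_toric_hom:
  "Poly_Mapping.lookup (toric_hom f) (k, b) =
     (\<Sum>m\<in>{m \<in> Poly_Mapping.keys f. size m = k \<and> sum_mset m = b}. Poly_Mapping.lookup f m)"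
  unfolding toric_hom_def lookup_sum lookup_single when_def
  by (subst sum.inter_filter) auto

text \<open>Being outside the initial forms of the toric ideal agrees with having minimal weight in the
  fiber over the corresponding lattice point, so \<^const>\<open>unique_standard_monomials\<close> indeed
  speaks about standard monomials.\<close>

theorem standard_monomial_iff:
  "standard_monomial P \<Sigma> m \<longleftrightarrow>
     is_arg_min (weight \<Sigma>) (\<lambda>u. u \<in> monomial_fiber P (size m) (sum_mset m)) m"
proof (cases "m \<in> monomials P")
  case False
  then show ?thesis by (simp add: standard_monomial_def is_arg_min_def monomial_fiber_def)
next
  case m: True
  show ?thesis
  proof
    assume std: "standard_monomial P \<Sigma> m"
    have False if u: "u \<in> monomials P" "size u = size m" "sum_mset u = sum_mset m"
      "weight \<Sigma> u < weight \<Sigma> m" for u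
    proof -
      define f where "f = Poly_Mapping.single m (1::complex) + Poly_Mapping.single u (-1)"
      have ne: "u \<noteq> m" using u by auto
      have k: "Poly_Mapping.keys f = {m, u}"
        using ne by (auto simp: f_def in_keys_iff lookup_add lookup_single when_def split: if_splits)
      have "toric_hom f = 0"
        by (simp add: f_def toric_hom_add toric_hom_single u flip: single_add)
      then have f: "f \<in> toric_ideal P"
        using k m u by (simp add: toric_ideal_def polynomial_ring_def)
      have "{m' \<in> Poly_Mapping.keys f. \<forall>m''\<in>Poly_Mapping.keys f. \<not> monomial_less \<Sigma> m' m''} = {m}"
        using u by (auto simp: k monomial_less_def)
      then have "initial_form \<Sigma> f = Poly_Mapping.single m 1"
        using ne by (simp add: initial_form_def f_def lookup_add lookup_single)
      then show False using std f by (auto simp: standard_monomial_def)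
    qed
    then show "is_arg_min (weight \<Sigma>) (\<lambda>u. u \<in> monomial_fiber P (size m) (sum_mset m)) m"
      using m by (auto simp: is_arg_min_def monomial_fiber_def)
  next
    assume min: "is_arg_min (weight \<Sigma>) (\<lambda>u. u \<in> monomial_fiber P (size m) (sum_mset m)) m"
    have False if f: "f \<in> toric_ideal P" and ini: "initial_form \<Sigma> f = Poly_Mapping.single m 1" for f
    proof -
      let ?T = "{m' \<in> Poly_Mapping.keys f. \<forall>m''\<in>Poly_Mapping.keys f. \<not> monomial_less \<Sigma> m' m''}"
      have look: "Poly_Mapping.lookup (initial_form \<Sigma> f) u = (if u \<in> ?T then Poly_Mapping.lookup f u else 0)" for u
        unfolding initial_form_def lookup_sum lookup_single when_def by simp
      have mT: "m \<in> ?T"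
        using look[of m] unfolding ini by (simp split: if_splits)
      have T: "u = m" if "u \<in> ?T" for u
      proof (rule ccontr)
        assume "u \<noteq> m"
        then show False using look[of u] that unfolding ini
          by (simp add: lookup_single in_keys_iff split: if_splits)
      qed
      let ?S = "{u \<in> Poly_Mapping.keys f. size u = size m \<and> sum_mset u = sum_mset m}"
      have "sum (Poly_Mapping.lookup f) ?S = 0"
        using f lookup_toric_hom[of f "size m" "sum_mset m"] by (simp add: toric_ideal_def)
      moreover have "?S = {m}"
      proof -
        have "u = m" if u: "u \<in> ?S" for u
        proof -
          have "u \<in> monomial_fiber P (size m) (sum_mset m)"
            using u f by (auto simp: toric_ideal_def polynomial_ring_def monomial_fiber_def)
          then have "weight \<Sigma> m \<le> weight \<Sigma> u"
            using min by (auto simp: is_arg_min_def not_less)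
          then have "u \<in> ?T"
            using mT u by (auto simp: monomial_less_def)
          then show ?thesis by (rule T)
        qed
        then show ?thesis using mT by auto
      qed
      ultimately show False using mT by (simp add: in_keys_iff)
    qed
    then show "standard_monomial P \<Sigma> m"
      using m by (auto simp: standard_monomial_def)
  qed
qed

end

theory Submission
  imports Defs
begin

text \<open>The heart of the matter is that a monomial of the fiber product is standard if and only if
  both of its projections are standard (\<open>standard_monomial_fiber_product_iff\<close>).

  The weight for \<open>sum_order\<close> is the sum of the weights of the projections, so two
  standard projections certainly give a standard monomial. Conversely, replace the two projections of
  a monomial \<open>m\<close> by standard monomials \<open>u\<^sub>1\<close> and \<open>u\<^sub>2\<close> over the same lattice points. Their images
  in \<open>Q\<close> are standard monomials of the same degree over the same lattice point, hence equal, because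
  standard monomials of \<open>Q\<close> are unique. Two multisets with equal images can be paired up
  element by element, so \<open>u\<^sub>1\<close> and \<open>u\<^sub>2\<close> are the projections of a single monomial \<open>u\<close> of the
  fiber product, which competes with \<open>m\<close>. If a projection of \<open>m\<close> were not standard, \<open>u\<close> would
  have strictly smaller weight than \<open>m\<close>.

  Being flag then passes from the factors to the fiber product, since the quadratic divisors
  of the projections of \<open>m\<close> are exactly the projections of the quadratic divisors of \<open>m\<close>,
  and powers of a variable project to powers of a variable.\<close>

section \<open>Multisets\<close>

lemma subseteq_image_msetE:
  assumes "A \<subseteq># image_mset f M"
  obtains B where "B \<subseteq># M" "image_mset f B = A"
proof -
  from assms obtain C where "image_mset f M = A + C"
    by (auto simp: subset_mset.le_iff_add)
  then obtain B C' where "M = B + C'" "A = image_mset f B"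
    using image_mset_eq_plusD by blast
  then show thesis
    using that[of B] by simp
qed

lemma all_submultisets_image_mset:
  "(\<forall>d. d \<subseteq># image_mset f m \<and> size d = n \<longrightarrow> R d) \<longleftrightarrow>
     (\<forall>d. d \<subseteq># m \<and> size d = n \<longrightarrow> R (image_mset f d))"
proof (intro iffI allI impI)
  fix d assume "\<forall>d. d \<subseteq># image_mset f m \<and> size d = n \<longrightarrow> R d" "d \<subseteq># m \<and> size d = n"
  then show "R (image_mset f d)"
    by (simp add: image_mset_subseteq_mono)
next
  fix d assume "\<forall>d. d \<subseteq># m \<and> size d = n \<longrightarrow> R (image_mset f d)" "d \<subseteq># image_mset f m \<and> size d = n"
  then show "R d"
    by (auto elim: subseteq_image_msetE)
qed

text \<open>Equality of the images says that the two multisets are related, element by element, by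
  having the same image; the witness of this relation is a multiset of pairs. The pairing
  is in general not unique.\<close>

lemma image_mset_eq_pairing:
  assumes "image_mset f A = image_mset g B"
  obtains M where "image_mset fst M = A" "image_mset snd M = B"
    "\<And>x y. (x, y) \<in># M \<Longrightarrow> f x = g y"
proof -
  have "rel_mset (=) (image_mset f A) (image_mset g B)"
    using assms by (simp add: multiset.rel_eq)
  then have "rel_mset (\<lambda>x y. f x = g y) A B"
    by (simp add: multiset.rel_map)
  then show thesis
    using that unfolding multiset.in_rel by blast
qed

lemma linear_sum_mset: "linear f \<Longrightarrow> f (sum_mset M) = sum_mset (image_mset f M)"
  by (induction M) (simp_all add: linear_0 linear_add)

lemma sum_mset_Pair:
  "sum_mset M = (sum_mset (image_mset fst M), sum_mset (image_mset snd M))"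
  by (induction M) (simp_all add: prod_eq_iff)

section \<open>Existence of standard monomials\<close>

lemma finite_bounded_int_lattice:
  fixes S :: "'a::euclidean_space set"
  assumes "bounded S"
  shows "finite (S \<inter> int_lattice)"
proof -
  obtain B where B: "\<And>x. x \<in> S \<Longrightarrow> norm x \<le> B"
    using assms by (auto simp: bounded_iff)
  let ?coords = "\<lambda>x. restrict ((\<bullet>) x) Basis"
  let ?K = "{k \<in> \<int>. \<bar>k\<bar> \<le> B}"
  have "?coords ` (S \<inter> int_lattice) \<subseteq> (\<Pi>\<^sub>E b\<in>Basis. ?K)"
    by (auto simp: int_lattice_def intro: order_trans[OF Basis_le_norm B])
  moreover have "finite (\<Pi>\<^sub>E b\<in>(Basis :: 'a set). ?K)"
    by (intro finite_PiE finite_Basis finite_abs_int_segment)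
  ultimately have "finite (?coords ` (S \<inter> int_lattice))"
    by (rule finite_subset)
  moreover have "inj_on ?coords (S \<inter> int_lattice)"
  proof (rule inj_onI, rule euclidean_eqI)
    fix x y b :: 'a assume eq: "?coords x = ?coords y" and b: "b \<in> Basis"
    from eq have "?coords x b = ?coords y b"
      by (rule fun_cong)
    then show "x \<bullet> b = y \<bullet> b"
      using b by simp
  qed
  ultimately show ?thesis
    by (rule finite_imageD)
qed

lemma finite_lattice_points:
  assumes "lattice_polytope P"
  shows "finite (lattice_points P)"
proof -
  have "bounded P"
    using assms by (auto simp: lattice_polytope_def intro: finite_imp_bounded_convex_hull)
  then show ?thesis
    unfolding lattice_points_def by (rule finite_bounded_int_lattice)
qed

lemma standard_monomialD:
  assumes "standard_monomial P \<Sigma> u"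
  shows "u \<in> monomials P"
    and "\<lbrakk>v \<in> monomials P; size v = size u; sum_mset v = sum_mset u\<rbrakk>
      \<Longrightarrow> weight \<Sigma> u \<le> weight \<Sigma> v"
  using assms by (auto simp: standard_monomial_iff is_arg_min_def monomial_fiber_def not_less)

lemma standard_monomialI:
  assumes "u \<in> monomials P"
    and "\<And>v. \<lbrakk>v \<in> monomials P; size v = size u; sum_mset v = sum_mset u\<rbrakk>
      \<Longrightarrow> weight \<Sigma> u \<le> weight \<Sigma> v"
  shows "standard_monomial P \<Sigma> u"
  using assms by (auto simp: standard_monomial_iff is_arg_min_def monomial_fiber_def not_less)

text \<open>A polytope has only finitely many lattice points, hence only finitely many monomials of
  each degree, so the minimal weight over a lattice point is attained.\<close>

lemma standard_monomial_exists:
  assumes "lattice_polytope P" and "m \<in> monomials P"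
  obtains u where "standard_monomial P \<Sigma> u" "size u = size m" "sum_mset u = sum_mset m"
proof -
  let ?F = "monomial_fiber P (size m) (sum_mset m)"
  have "?F \<subseteq> multisets_of_size (lattice_points P) (size m)"
    by (auto simp: monomial_fiber_def monomials_def multisets_of_size_def)
  then have "finite ?F"
    using finite_lattice_points[OF assms(1)] finite_multisets_of_size finite_subset by blast
  moreover have "?F \<noteq> {}"
    using assms(2) by (auto simp: monomial_fiber_def)
  ultimately obtain u where u: "is_arg_min (weight \<Sigma>) (\<lambda>u. u \<in> ?F) u"
    using ex_is_arg_min_if_finite by blast
  then have "size u = size m" "sum_mset u = sum_mset m"
    by (auto simp: is_arg_min_def monomial_fiber_def)
  with u show thesis
    using that by (simp add: standard_monomial_iff)
qed

lemma standard_monomial_unique: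
  assumes "unique_standard_monomials Q \<Sigma>"
    and u: "standard_monomial Q \<Sigma> u" and v: "standard_monomial Q \<Sigma> v"
    and eq: "size u = size v" "sum_mset u = sum_mset v"
  shows "u = v"
proof -
  let ?F = "monomial_fiber Q (size u) (sum_mset u)"
  have "u \<in> monomials Q"
    using u by (rule standard_monomialD)
  then have "u \<in> ?F" "sum_mset u \<in> lattice_points (minkowski_multiple (size u) Q)"
    by (simp_all add: monomial_fiber_def sum_mset_monomial)
  then have "\<exists>!w. is_arg_min (weight \<Sigma>) (\<lambda>w. w \<in> ?F) w"
    using assms(1) unfolding unique_standard_monomials_def by blast
  moreover have "is_arg_min (weight \<Sigma>) (\<lambda>w. w \<in> ?F) u" "is_arg_min (weight \<Sigma>) (\<lambda>w. w \<in> ?F) v"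
    using u v by (simp_all only: standard_monomial_iff eq)
  ultimately show ?thesis
    by blast
qed

section \<open>Monomials of a fiber product\<close>

lemma weight_sum_order:
  "weight (sum_order \<Sigma>\<^sub>1 \<Sigma>\<^sub>2) m =
     weight \<Sigma>\<^sub>1 (image_mset fst m) + weight \<Sigma>\<^sub>2 (image_mset snd m)"
  by (induction m) (auto simp: weight_def sum_order_def)

lemma lattice_points_fiber_product:
  "(x, y) \<in> lattice_points (fiber_product P\<^sub>1 P\<^sub>2 \<pi>\<^sub>1 \<pi>\<^sub>2) \<longleftrightarrow>
     x \<in> lattice_points P\<^sub>1 \<and> y \<in> lattice_points P\<^sub>2 \<and> \<pi>\<^sub>1 x = \<pi>\<^sub>2 y"
  by (subst lattice_points_def, subst int_lattice_Times)
     (auto simp: fiber_product_def lattice_points_def)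

lemma monomials_fiber_product:
  "m \<in> monomials (fiber_product P\<^sub>1 P\<^sub>2 \<pi>\<^sub>1 \<pi>\<^sub>2) \<longleftrightarrow>
     image_mset fst m \<in> monomials P\<^sub>1 \<and> image_mset snd m \<in> monomials P\<^sub>2 \<and>
     (\<forall>(x, y)\<in>#m. \<pi>\<^sub>1 x = \<pi>\<^sub>2 y)"
  unfolding monomials_def
  by (force simp: lattice_points_fiber_product)

lemma image_mset_projections_eq:
  "\<forall>(x, y)\<in>#m. f x = g y \<Longrightarrow> image_mset f (image_mset fst m) = image_mset g (image_mset snd m)"
  by (auto simp: multiset.map_comp intro!: image_mset_cong)

text \<open>The nontrivial direction lets a monomial with standard projections compete with
  \<open>m\<close>. It lies in the fiber product because its projections have the same
  image in \<open>Q\<close>, which is where the uniqueness of standard monomials of \<open>Q\<close> enters.\<close>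

lemma standard_monomial_fiber_product_iff:
  assumes P: "lattice_polytope P\<^sub>1" "lattice_polytope P\<^sub>2"
    and \<pi>\<^sub>1: "polytope_morphism \<pi>\<^sub>1 P\<^sub>1 \<Sigma>\<^sub>1 Q \<Sigma>"
    and \<pi>\<^sub>2: "polytope_morphism \<pi>\<^sub>2 P\<^sub>2 \<Sigma>\<^sub>2 Q \<Sigma>"
    and Q: "unique_standard_monomials Q \<Sigma>"
    and m: "m \<in> monomials (fiber_product P\<^sub>1 P\<^sub>2 \<pi>\<^sub>1 \<pi>\<^sub>2)"
  shows "standard_monomial (fiber_product P\<^sub>1 P\<^sub>2 \<pi>\<^sub>1 \<pi>\<^sub>2) (sum_order \<Sigma>\<^sub>1 \<Sigma>\<^sub>2) m \<longleftrightarrow>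
     standard_monomial P\<^sub>1 \<Sigma>\<^sub>1 (image_mset fst m) \<and> standard_monomial P\<^sub>2 \<Sigma>\<^sub>2 (image_mset snd m)"
    (is "standard_monomial ?P ?\<Sigma> m \<longleftrightarrow> ?std\<^sub>1 \<and> ?std\<^sub>2")
proof
  let ?m\<^sub>1 = "image_mset fst m" and ?m\<^sub>2 = "image_mset snd m"
  have m\<^sub>1: "?m\<^sub>1 \<in> monomials P\<^sub>1" and m\<^sub>2: "?m\<^sub>2 \<in> monomials P\<^sub>2"
    and images: "image_mset \<pi>\<^sub>1 ?m\<^sub>1 = image_mset \<pi>\<^sub>2 ?m\<^sub>2"
    using m image_mset_projections_eq unfolding monomials_fiber_product by blast+
  assume std: "standard_monomial ?P ?\<Sigma> m"
  obtain u\<^sub>1 where u\<^sub>1: "standard_monomial P\<^sub>1 \<Sigma>\<^sub>1 u\<^sub>1"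
      "size u\<^sub>1 = size ?m\<^sub>1" "sum_mset u\<^sub>1 = sum_mset ?m\<^sub>1"
    using standard_monomial_exists[OF P(1) m\<^sub>1] by blast
  obtain u\<^sub>2 where u\<^sub>2: "standard_monomial P\<^sub>2 \<Sigma>\<^sub>2 u\<^sub>2"
      "size u\<^sub>2 = size ?m\<^sub>2" "sum_mset u\<^sub>2 = sum_mset ?m\<^sub>2"
    using standard_monomial_exists[OF P(2) m\<^sub>2] by blast
  have "image_mset \<pi>\<^sub>1 u\<^sub>1 = image_mset \<pi>\<^sub>2 u\<^sub>2"
  proof (rule standard_monomial_unique[OF Q])
    show "standard_monomial Q \<Sigma> (image_mset \<pi>\<^sub>1 u\<^sub>1)" "standard_monomial Q \<Sigma> (image_mset \<pi>\<^sub>2 u\<^sub>2)"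
      using \<pi>\<^sub>1 \<pi>\<^sub>2 u\<^sub>1(1) u\<^sub>2(1) by (simp_all add: polytope_morphism_def)
    show "size (image_mset \<pi>\<^sub>1 u\<^sub>1) = size (image_mset \<pi>\<^sub>2 u\<^sub>2)"
      using u\<^sub>1(2) u\<^sub>2(2) by simp
    have lin: "linear \<pi>\<^sub>1" "linear \<pi>\<^sub>2"
      using \<pi>\<^sub>1 \<pi>\<^sub>2 by (simp_all add: polytope_morphism_def)
    have "\<pi>\<^sub>1 (sum_mset u\<^sub>1) = \<pi>\<^sub>2 (sum_mset u\<^sub>2)"
      unfolding u\<^sub>1(3) u\<^sub>2(3) linear_sum_mset[OF lin(1)] linear_sum_mset[OF lin(2)] images ..
    then show "sum_mset (image_mset \<pi>\<^sub>1 u\<^sub>1) = sum_mset (image_mset \<pi>\<^sub>2 u\<^sub>2)"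
      by (simp add: linear_sum_mset lin)
  qed
  then obtain u where u: "image_mset fst u = u\<^sub>1" "image_mset snd u = u\<^sub>2"
    and over: "\<And>x y. (x, y) \<in># u \<Longrightarrow> \<pi>\<^sub>1 x = \<pi>\<^sub>2 y"
    by (rule image_mset_eq_pairing) blast
  have "u \<in> monomials ?P"
    using u over u\<^sub>1(1) u\<^sub>2(1) by (auto simp: monomials_fiber_product dest: standard_monomialD(1))
  moreover have "size u = size m"
    using u(1) u\<^sub>1(2) by auto
  moreover have "sum_mset u = sum_mset m"
    by (simp add: sum_mset_Pair[of u] sum_mset_Pair[of m] u u\<^sub>1(3) u\<^sub>2(3))
  ultimately have "weight ?\<Sigma> m \<le> weight ?\<Sigma> u"
    using standard_monomialD(2)[OF std] by blast
  then have sum: "weight \<Sigma>\<^sub>1 ?m\<^sub>1 + weight \<Sigma>\<^sub>2 ?m\<^sub>2 \<le> weight \<Sigma>\<^sub>1 u\<^sub>1 + weight \<Sigma>\<^sub>2 u\<^sub>2"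
    by (simp add: weight_sum_order u)
  have "weight \<Sigma>\<^sub>1 u\<^sub>1 \<le> weight \<Sigma>\<^sub>1 ?m\<^sub>1" "weight \<Sigma>\<^sub>2 u\<^sub>2 \<le> weight \<Sigma>\<^sub>2 ?m\<^sub>2"
    using standard_monomialD(2)[OF u\<^sub>1(1) m\<^sub>1] standard_monomialD(2)[OF u\<^sub>2(1) m\<^sub>2] u\<^sub>1 u\<^sub>2 by simp_all
  \<comment> \<open>Two inequalities whose sum is an equality are equalities.\<close>
  with sum have le: "weight \<Sigma>\<^sub>1 ?m\<^sub>1 \<le> weight \<Sigma>\<^sub>1 u\<^sub>1" "weight \<Sigma>\<^sub>2 ?m\<^sub>2 \<le> weight \<Sigma>\<^sub>2 u\<^sub>2"
    by linarith+
  have ?std\<^sub>1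
    using le(1) standard_monomialD(2)[OF u\<^sub>1(1)] u\<^sub>1(2,3)
    by (intro standard_monomialI m\<^sub>1) (metis order_trans)
  moreover have ?std\<^sub>2
    using le(2) standard_monomialD(2)[OF u\<^sub>2(1)] u\<^sub>2(2,3)
    by (intro standard_monomialI m\<^sub>2) (metis order_trans)
  ultimately show "?std\<^sub>1 \<and> ?std\<^sub>2" ..
next
  assume std: "?std\<^sub>1 \<and> ?std\<^sub>2"
  show "standard_monomial ?P ?\<Sigma> m"
  proof (rule standard_monomialI[OF m])
    fix v assume v: "v \<in> monomials ?P" "size v = size m" "sum_mset v = sum_mset m"
    from v(3) have "sum_mset (image_mset fst v) = sum_mset (image_mset fst m)"
      "sum_mset (image_mset snd v) = sum_mset (image_mset snd m)"
      by (simp_all add: sum_mset_Pair[of v] sum_mset_Pair[of m])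
    then show "weight ?\<Sigma> m \<le> weight ?\<Sigma> v"
      using std v(1,2) unfolding weight_sum_order
      by (intro add_mono standard_monomialD(2)) (auto simp: monomials_fiber_product)
  qed
qed

section \<open>Flagness\<close>

theorem proposition1p19:
  fixes P\<^sub>1 :: "'a::euclidean_space set" and \<Sigma>\<^sub>1 :: "'a \<Rightarrow> real"
    and P\<^sub>2 :: "'b::euclidean_space set" and \<Sigma>\<^sub>2 :: "'b \<Rightarrow> real"
    and Q :: "'c::euclidean_space set" and \<Sigma> :: "'c \<Rightarrow> real"
    and \<pi>\<^sub>1 :: "'a \<Rightarrow> 'c" and \<pi>\<^sub>2 :: "'b \<Rightarrow> 'c"
  assumes "lattice_polytope P\<^sub>1" and "lattice_polytope P\<^sub>2" and "lattice_polytope Q"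
    and "polytope_morphism \<pi>\<^sub>1 P\<^sub>1 \<Sigma>\<^sub>1 Q \<Sigma>" and "polytope_morphism \<pi>\<^sub>2 P\<^sub>2 \<Sigma>\<^sub>2 Q \<Sigma>"
    and "unique_standard_monomials Q \<Sigma>"
    and "flag P\<^sub>1 \<Sigma>\<^sub>1" and "flag P\<^sub>2 \<Sigma>\<^sub>2"
  shows "flag (fiber_product P\<^sub>1 P\<^sub>2 \<pi>\<^sub>1 \<pi>\<^sub>2) (sum_order \<Sigma>\<^sub>1 \<Sigma>\<^sub>2)"
proof -
  let ?P = "fiber_product P\<^sub>1 P\<^sub>2 \<pi>\<^sub>1 \<pi>\<^sub>2" and ?\<Sigma> = "sum_order \<Sigma>\<^sub>1 \<Sigma>\<^sub>2"
  note std_iff = standard_monomial_fiber_product_iff[OF assms(1,2,4,5,6)]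
  have flag\<^sub>1: "standard_monomial P\<^sub>1 \<Sigma>\<^sub>1 m \<longleftrightarrow>
      (\<forall>d. d \<subseteq># m \<and> size d = 2 \<longrightarrow> standard_monomial P\<^sub>1 \<Sigma>\<^sub>1 d)" if "m \<in> monomials P\<^sub>1" for m
    using assms(7) that by (simp add: flag_def)
  have flag\<^sub>2: "standard_monomial P\<^sub>2 \<Sigma>\<^sub>2 m \<longleftrightarrow>
      (\<forall>d. d \<subseteq># m \<and> size d = 2 \<longrightarrow> standard_monomial P\<^sub>2 \<Sigma>\<^sub>2 d)" if "m \<in> monomials P\<^sub>2" for m
    using assms(8) that by (simp add: flag_def)
  have "standard_monomial ?P ?\<Sigma> m \<longleftrightarrow>
      (\<forall>d. d \<subseteq># m \<and> size d = 2 \<longrightarrow> standard_monomial ?P ?\<Sigma> d)" if m: "m \<in> monomials ?P" for m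
  proof -
    have d: "d \<in> monomials ?P" if "d \<subseteq># m" for d
      using m set_mset_mono[OF that] by (auto simp: monomials_def)
    have "standard_monomial ?P ?\<Sigma> m \<longleftrightarrow>
        (\<forall>d. d \<subseteq># m \<and> size d = 2 \<longrightarrow> standard_monomial P\<^sub>1 \<Sigma>\<^sub>1 (image_mset fst d)) \<and>
        (\<forall>d. d \<subseteq># m \<and> size d = 2 \<longrightarrow> standard_monomial P\<^sub>2 \<Sigma>\<^sub>2 (image_mset snd d))"
      using m by (simp add: std_iff monomials_fiber_product flag\<^sub>1 flag\<^sub>2 all_submultisets_image_mset)
    then show ?thesis
      using std_iff[OF d] by blast
  qed
  moreover have "standard_monomial ?P ?\<Sigma> (replicate_mset n z)" if z: "z \<in> lattice_points ?P" for z n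
  proof -
    have "fst z \<in> lattice_points P\<^sub>1" "snd z \<in> lattice_points P\<^sub>2"
      using z by (cases z; simp add: lattice_points_fiber_product)+
    then have "standard_monomial P\<^sub>1 \<Sigma>\<^sub>1 (replicate_mset n (fst z))"
      "standard_monomial P\<^sub>2 \<Sigma>\<^sub>2 (replicate_mset n (snd z))"
      using assms(7,8) by (simp_all add: flag_def)
    moreover have "replicate_mset n z \<in> monomials ?P"
      using z by (auto simp: monomials_def)
    ultimately show ?thesis
      by (simp add: std_iff)
  qed
  ultimately show ?thesis
    by (simp add: flag_def)
qed

end
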